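(* Let $\nu\ge 0$ and let $g\in C[0,\infty)\cap E$, where $E$ is the set of functions $g$ on $[0,\infty)$ such that $\frac{g(x)}{1+x^{2}}$ converges (to a finite limit) as $x\to\infty$. Then for every compact set $A\subset[0,\infty)$, $T_n(g;x)\to g(x)$ uniformly in $x\in A$ as $n\to\infty$.
   Context: Fix a real $\nu\ge 0$. For $r\in\mathbb{N}_0$ let $$\gamma_\nu(2r)=\frac{2^{2r}\,r!\,\Gamma(r+\nu+1/2)}{\Gamma(\nu+1/2)},\qquad \gamma_\nu(2r+1)=\frac{2^{2r+1}\,r!\,\Gamma(r+\nu+3/2)}{\Gamma(\nu+1/2)},$$ and $e_\nu(x)=\sum_{r=0}^{\infty}\frac{x^r}{\gamma_\nu(r)}$. For an integer $n\ge 1$, $x\ge 0$ and a continuous function $g$ on $[0,\infty)$ for which the integrals exist finitely, define $$T_n(g;x)=\frac{n-1}{e_\nu(nx)}\sum_{r=1}^{\infty}\binom{n+r-2}{r-1}\frac{(nx)^r}{\gamma_\nu(r)}\int_0^\infty s^{r-1}(1+s)^{-n-r+1}g(s)\,ds+\frac{g(0)}{e_\nu(nx)}.$$ For functions with growth $O(1+x^2)$ the operator is considered for $n>3$. *)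

theory Defs
  imports "HOL-Analysis.Analysis"
begin

definition gamma_dunkl :: "real \<Rightarrow> nat \<Rightarrow> real" where
  "gamma_dunkl \<nu> k =
     (let r = k div 2 in
      if even k
      then 2 ^ (2 * r) * fact r * Gamma (real r + \<nu> + 1/2) / Gamma (\<nu> + 1/2)
      else 2 ^ (2 * r + 1) * fact r * Gamma (real r + \<nu> + 3/2) / Gamma (\<nu> + 1/2))"

definition exp_dunkl :: "real \<Rightarrow> real \<Rightarrow> real" where
  "exp_dunkl \<nu> x = (\<Sum>r. x ^ r / gamma_dunkl \<nu> r)"

text \<open>
  The summand with index \<open>r \<ge> 1\<close> of the series defining \<open>T\<^sub>n(g; x)\<close>.
  For \<open>n, r \<ge> 1\<close> the subtractions on natural numbers do not truncate.
\<close>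

definition T_summand :: "real \<Rightarrow> nat \<Rightarrow> (real \<Rightarrow> real) \<Rightarrow> real \<Rightarrow> nat \<Rightarrow> real" where
  "T_summand \<nu> n g x r =
     real ((n + r - 2) choose (r - 1)) * ((real n * x) ^ r / gamma_dunkl \<nu> r) *
     (LBINT s:{0..}. s ^ (r - 1) * (1 + s) powi (- int n - int r + 1) * g s)"

text \<open>
  The series starts at \<open>r = 1\<close>, hence the shift by \<open>Suc\<close>.  The operator is meant for
  \<open>n \<ge> 1\<close> and functions \<open>g\<close> whose integrals exist; for continuous \<open>g\<close> of growth
  \<open>O(1 + x\<^sup>2)\<close> this is the case for all \<open>n > 3\<close>.
\<close>

definition T_op :: "real \<Rightarrow> nat \<Rightarrow> (real \<Rightarrow> real) \<Rightarrow> real \<Rightarrow> real" where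
  "T_op \<nu> n g x =
     (real n - 1) / exp_dunkl \<nu> (real n * x) * (\<Sum>k. T_summand \<nu> n g x (Suc k))
     + g 0 / exp_dunkl \<nu> (real n * x)"

text \<open>Functions on \<open>[0, \<infinity>)\<close> are total functions whose values at negative arguments are irrelevant.\<close>

definition E_space :: "(real \<Rightarrow> real) set" where
  "E_space = {g. \<exists>l. ((\<lambda>x. g x / (1 + x\<^sup>2)) \<longlongrightarrow> l) at_top}"

end

theory Submission
  imports Defs "HOL-Real_Asymp.Real_Asymp"
begin

text \<open>
  The operators are averages, and they concentrate at \<open>x\<close>.  Put \<open>y = n x\<close> and
  \<open>p\<^sub>r = y\<^sup>r / (\<gamma>\<^sub>\<nu>(r) e\<^sub>\<nu>(y))\<close>, a probability distribution on the natural numbers.  The binomial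
  coefficient and the factor \<open>n - 1\<close> turn the kernel \<open>s\<^bsup>r-1\<^esup> (1 + s)\<^bsup>-n-r+1\<^esup>\<close> into the density of the
  beta prime distribution with parameters \<open>r\<close> and \<open>n - 1\<close>.  Hence \<open>T\<^sub>n(g; x)\<close> is the expectation of \<open>g(S)\<close>,
  where \<open>r\<close> is drawn according to \<open>p\<close> and then \<open>S\<close> from that beta prime distribution (with \<open>S = 0\<close> if \<open>r = 0\<close>).

  Convergence then follows from a second moment estimate, as in Chebyshev's proof of the weak law of
  large numbers.  A continuous \<open>g\<close> with \<open>g(s) = O(1 + s\<^sup>2)\<close> satisfies
  \<open>\<bar>g s - g x\<bar> \<le> \<epsilon> + M (s - x)\<^sup>2\<close> for all \<open>s \<ge> 0\<close> and all \<open>x\<close> in a bounded interval, with \<open>M\<close> depending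
  only on \<open>\<epsilon>\<close> and the interval (\<open>quadratic_modulus\<close>): near \<open>x\<close> by uniform continuity, far from \<open>x\<close>
  because the quadratic term beats the growth.  Averaging gives
  \<open>\<bar>T\<^sub>n(g; x) - g x\<bar> \<le> \<epsilon> + M E((S - x)\<^sup>2)\<close>, and it remains to see that the second moment is \<open>O(1/n)\<close>
  locally uniformly in \<open>x\<close>.

  Given \<open>r\<close>, the first two moments of \<open>S\<close> are \<open>r / (n - 2)\<close> and \<open>r (r + 1) / ((n - 2) (n - 3))\<close>, by
  explicit integration (\<open>has_integral_beta_prime\<close>).  For the moments of \<open>r\<close> one uses that \<open>\<gamma>\<^sub>\<nu>\<close> is a factorial built from
  the numbers \<open>[r] = r + 2 \<nu> (r mod 2)\<close>, that is \<open>\<gamma>\<^sub>\<nu>(r) = [r] \<gamma>\<^sub>\<nu>(r - 1)\<close>.  Therefore \<open>E [r] = y\<close> and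
  \<open>E ([r] [r - 1]) = y\<^sup>2\<close> exactly, just as for factorial moments of a Poisson variable, and \<open>r\<close> differs from
  \<open>[r]\<close> by at most \<open>2 \<nu>\<close>.  These facts are combined in \<open>T_op_deviation\<close>.
\<close>

section \<open>The Dunkl factorials\<close>

definition dunkl_nat :: "real \<Rightarrow> nat \<Rightarrow> real" where
  "dunkl_nat \<nu> r = real r + (if odd r then 2 * \<nu> else 0)"

lemma gamma_dunkl_0:
  assumes "\<nu> \<ge> 0"
  shows "gamma_dunkl \<nu> 0 = 1"
proof -
  have "Gamma (\<nu> + 1/2) > 0"
    using assms by (intro Gamma_real_pos) auto
  then show ?thesis
    by (simp add: gamma_dunkl_def)
qed

text \<open>
  The two Gamma arguments in the definition interlace: passing from an even to an odd index raises the
  argument by one and leaves \<open>r!\<close> alone, passing from an odd to an even index only extends \<open>r!\<close>.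
\<close>

lemma gamma_dunkl_Suc:
  assumes "\<nu> \<ge> 0"
  shows "gamma_dunkl \<nu> (Suc r) = dunkl_nat \<nu> (Suc r) * gamma_dunkl \<nu> r"
proof (cases "even r")
  case True
  then obtain q where q: "r = 2 * q" by (elim evenE)
  have "Gamma ((real q + \<nu> + 1/2) + 1) = (real q + \<nu> + 1/2) * Gamma (real q + \<nu> + 1/2)"
    using assms by (intro Gamma_plus1) (auto elim!: nonpos_Ints_cases)
  then have "Gamma (real q + \<nu> + 3/2) = (real q + \<nu> + 1/2) * Gamma (real q + \<nu> + 1/2)"
    by (simp add: add.assoc)
  then have "gamma_dunkl \<nu> (Suc r) = 2 ^ (2 * q + 1) * fact q *
      ((real q + \<nu> + 1/2) * Gamma (real q + \<nu> + 1/2)) / Gamma (\<nu> + 1/2)"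
    by (simp add: q gamma_dunkl_def)
  also have "\<dots> = (2 * (real q + \<nu> + 1/2)) *
      (2 ^ (2 * q) * fact q * Gamma (real q + \<nu> + 1/2) / Gamma (\<nu> + 1/2))"
    by simp
  also have "2 * (real q + \<nu> + 1/2) = dunkl_nat \<nu> (Suc r)"
    by (simp add: q dunkl_nat_def)
  finally show ?thesis
    by (simp add: q gamma_dunkl_def)
next
  case False
  then obtain q where q: "r = 2 * q + 1" by (elim oddE)
  have "gamma_dunkl \<nu> (Suc r) =
          2 ^ (2 * Suc q) * fact (Suc q) * Gamma (real (Suc q) + \<nu> + 1/2) / Gamma (\<nu> + 1/2)"
    by (simp add: q gamma_dunkl_def)
  also have "real (Suc q) + \<nu> + 1/2 = real q + \<nu> + 3/2" by simp
  finally show ?thesis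
    by (simp add: q gamma_dunkl_def dunkl_nat_def field_simps)
qed

lemma dunkl_nat_ge: "\<nu> \<ge> 0 \<Longrightarrow> real r \<le> dunkl_nat \<nu> r"
  by (simp add: dunkl_nat_def)

lemma gamma_dunkl_ge_fact:
  assumes "\<nu> \<ge> 0"
  shows "fact r \<le> gamma_dunkl \<nu> r"
proof (induction r)
  case 0
  then show ?case by (simp add: gamma_dunkl_0 assms)
next
  case (Suc r)
  have "fact (Suc r) = real (Suc r) * fact r" by simp
  also have "\<dots> \<le> dunkl_nat \<nu> (Suc r) * gamma_dunkl \<nu> r"
    using Suc dunkl_nat_ge[OF assms, of "Suc r"] by (intro mult_mono) auto
  finally show ?case by (simp add: gamma_dunkl_Suc assms)
qed

lemma gamma_dunkl_pos:
  assumes "\<nu> \<ge> 0"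
  shows "gamma_dunkl \<nu> r > 0"
  using gamma_dunkl_ge_fact[OF assms, of r] fact_gt_zero[of r, where 'a = real] by linarith

section \<open>Moments of the Dunkl--Poisson weights\<close>

lemma exp_dunkl_sums:
  fixes y :: real
  assumes "\<nu> \<ge> 0"
  shows "(\<lambda>r. y ^ r / gamma_dunkl \<nu> r) sums exp_dunkl \<nu> y"
proof -
  have "summable (\<lambda>r. y ^ r / gamma_dunkl \<nu> r)"
  proof (rule summable_comparison_test')
    show "summable (\<lambda>r. inverse (fact r) * \<bar>y\<bar> ^ r)"
      by (rule summable_exp)
    show "norm (y ^ r / gamma_dunkl \<nu> r) \<le> inverse (fact r) * \<bar>y\<bar> ^ r" for r
    proof -
      have "\<bar>y\<bar> ^ r / gamma_dunkl \<nu> r \<le> \<bar>y\<bar> ^ r / fact r"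
        using gamma_dunkl_ge_fact[OF assms, of r] gamma_dunkl_pos[OF assms, of r]
        by (intro divide_left_mono) auto
      then show ?thesis
        using gamma_dunkl_pos[OF assms, of r]
        by (simp add: power_abs abs_mult divide_inverse mult.commute)
    qed
  qed
  then show ?thesis
    unfolding exp_dunkl_def by (rule summable_sums)
qed

lemma exp_dunkl_pos:
  assumes "\<nu> \<ge> 0" "y \<ge> 0"
  shows "exp_dunkl \<nu> y > 0"
proof -
  have "(\<lambda>r. if r = 0 then 1 else 0) sums (1 :: real)"
    using sums_single[of 0 "\<lambda>_. 1 :: real"] by simp
  then have "1 \<le> exp_dunkl \<nu> y"
    using exp_dunkl_sums[OF assms(1), of y] assms gamma_dunkl_pos[OF assms(1)]
    by (elim sums_le[rotated]) (auto simp: gamma_dunkl_0 less_imp_le)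
  then show ?thesis by simp
qed

text \<open>
  The factor \<open>dunkl_nat \<nu> r\<close> cancels the last factor of \<open>gamma_dunkl \<nu> r\<close>, so that it shifts the
  series by one index.  The next two lemmas play the role of the first two factorial moments of a
  Poisson distribution.
\<close>

lemma dunkl_nat_sums:
  fixes y :: real
  assumes "\<nu> \<ge> 0"
  shows "(\<lambda>r. dunkl_nat \<nu> r * (y ^ r / gamma_dunkl \<nu> r)) sums (y * exp_dunkl \<nu> y)"
proof -
  have "dunkl_nat \<nu> (Suc r) \<noteq> 0" for r
    using dunkl_nat_ge[OF assms, of "Suc r"] by auto
  then have "dunkl_nat \<nu> (Suc r) * (y ^ Suc r / gamma_dunkl \<nu> (Suc r)) =
        y * (y ^ r / gamma_dunkl \<nu> r)" for r
    by (simp add: gamma_dunkl_Suc assms)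
  then have "(\<lambda>r. dunkl_nat \<nu> (Suc r) * (y ^ Suc r / gamma_dunkl \<nu> (Suc r)))
        sums (y * exp_dunkl \<nu> y)"
    using sums_mult[OF exp_dunkl_sums[OF assms]] by simp
  then show ?thesis
    by (subst (asm) sums_Suc_iff) (simp add: dunkl_nat_def)
qed

lemma dunkl_nat_dunkl_nat_sums:
  fixes y :: real
  assumes "\<nu> \<ge> 0"
  shows "(\<lambda>r. dunkl_nat \<nu> r * dunkl_nat \<nu> (r - 1) * (y ^ r / gamma_dunkl \<nu> r))
           sums (y\<^sup>2 * exp_dunkl \<nu> y)"
proof -
  have "dunkl_nat \<nu> (Suc r) \<noteq> 0" for r
    using dunkl_nat_ge[OF assms, of "Suc r"] by auto
  then have "dunkl_nat \<nu> (Suc r) * dunkl_nat \<nu> (Suc r - 1) *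
        (y ^ Suc r / gamma_dunkl \<nu> (Suc r)) =
        y * (dunkl_nat \<nu> r * (y ^ r / gamma_dunkl \<nu> r))" for r
    by (simp add: gamma_dunkl_Suc assms)
  then have "(\<lambda>r. dunkl_nat \<nu> (Suc r) * dunkl_nat \<nu> (Suc r - 1) *
        (y ^ Suc r / gamma_dunkl \<nu> (Suc r))) sums (y\<^sup>2 * exp_dunkl \<nu> y)"
    using sums_mult[OF dunkl_nat_sums[OF assms], of y y]
    by (simp add: power2_eq_square mult.assoc)
  then show ?thesis
    by (subst (asm) sums_Suc_iff) (simp add: dunkl_nat_def)
qed

text \<open>
  The beta prime averages produce the quantities \<open>r\<close>, with a negative sign, and \<open>r (r + 1)\<close>.  A lower
  bound for the former and an upper bound for the latter in terms of Dunkl factorial moments are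
  enough to bound the second moment from above.
\<close>

lemma dunkl_nat_minus_le:
  "\<nu> \<ge> 0 \<Longrightarrow> dunkl_nat \<nu> r - 2 * \<nu> \<le> real r"
  by (simp add: dunkl_nat_def)

lemma rising_product_le_dunkl_nat:
  assumes "\<nu> \<ge> 0"
  shows "real r * (real r + 1) \<le>
           dunkl_nat \<nu> r * dunkl_nat \<nu> (r - 1) + 2 * dunkl_nat \<nu> r"
proof (cases r)
  case (Suc q)
  then show ?thesis
    using assms by (auto simp: dunkl_nat_def algebra_simps)
qed (simp add: dunkl_nat_def)

section \<open>Beta prime averages\<close>

text \<open>
  Writing \<open>s = (1 + s) - 1\<close> in the numerator expresses the integral for exponent \<open>a + 1\<close> as a difference
  of two integrals for exponent \<open>a\<close>, which leaves only the case \<open>a = 0\<close> to be integrated.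
\<close>

lemma has_integral_beta_prime:
  "has_bochner_integral lborel
     (\<lambda>s::real. indicator {0..} s * (s ^ a / (1 + s) ^ (a + k + 2)))
     (fact a * fact k / fact (a + k + 1))"
proof (induction a arbitrary: k)
  case 0
  have "has_bochner_integral lborel
          (\<lambda>s::real. (1 / (1 + s) ^ (k + 2)) * indicator {0..} s) (1 / (real k + 1))"
  proof (rule has_bochner_integral_nn_integral)
    let ?F = "\<lambda>s::real. - (inverse (1 + s) ^ Suc k / (real k + 1))"
    have "(?F has_field_derivative 1 / (1 + s) ^ (k + 2)) (at s)" if "0 \<le> s" for s
    proof -
      have "1 + s \<noteq> 0" using that by simp
      then have "((\<lambda>s. inverse (1 + s)) has_field_derivative - inverse ((1 + s)\<^sup>2)) (at s)"
        by (auto intro!: derivative_eq_intros simp: power2_eq_square)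
      then have "(?F has_field_derivative
          - ((1 + real k) * (- inverse ((1 + s)\<^sup>2) * inverse (1 + s) ^ k) / (real k + 1))) (at s)"
        by (intro DERIV_minus DERIV_cdivide DERIV_power_Suc)
      also have "- ((1 + real k) * (- inverse ((1 + s)\<^sup>2) * inverse (1 + s) ^ k) / (real k + 1))
          = inverse ((1 + s)\<^sup>2) * inverse (1 + s) ^ k"
        by (simp add: add.commute[of 1] add_eq_0_iff)
      also have "\<dots> = 1 / (1 + s) ^ (k + 2)"
        by (simp add: power_add divide_inverse power_inverse power2_eq_square)
      finally show ?thesis .
    qed
    moreover have "(?F \<longlongrightarrow> 0) at_top"
    proof -
      have "filterlim (\<lambda>s::real. 1 + s) at_top at_top"
        by (intro filterlim_tendsto_add_at_top[OF tendsto_const] filterlim_ident)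
      then have "((\<lambda>s::real. inverse (1 + s)) \<longlongrightarrow> 0) at_top"
        by (rule tendsto_inverse_0_at_top)
      then have "(?F \<longlongrightarrow> - (0 ^ Suc k / (real k + 1))) at_top"
        by (intro tendsto_intros) auto
      then show ?thesis by simp
    qed
    ultimately have "(\<integral>\<^sup>+s. ennreal (1 / (1 + s) ^ (k + 2)) * indicator {0..} s \<partial>lborel)
        = ennreal (0 - ?F 0)"
      by (intro nn_integral_FTC_atLeast) auto
    then show "(\<integral>\<^sup>+s. ennreal (1 / (1 + s) ^ (k + 2) * indicator {0..} s) \<partial>lborel)
        = ennreal (1 / (real k + 1))"
      by (simp add: indicator_mult_ennreal flip: ennreal_indicator ennreal_mult'')
  qed (auto split: split_indicator)
  then show ?case
    by (simp add: mult.commute add.commute)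
next
  case (Suc a)
  have "has_bochner_integral lborel
     (\<lambda>s::real. indicator {0..} s * (s ^ a / (1 + s) ^ (a + k + 2))
              - indicator {0..} s * (s ^ a / (1 + s) ^ (a + Suc k + 2)))
     (fact a * fact k / fact (a + k + 1) - fact a * fact (Suc k) / fact (a + Suc k + 1))"
    using Suc by (intro has_bochner_integral_diff)
  also have "(\<lambda>s::real. indicator {0..} s * (s ^ a / (1 + s) ^ (a + k + 2))
              - indicator {0..} s * (s ^ a / (1 + s) ^ (a + Suc k + 2))) =
        (\<lambda>s. indicator {0..} s * (s ^ Suc a / (1 + s) ^ (Suc a + k + 2)))"
  proof
    show "indicator {0..} s * (s ^ a / (1 + s) ^ (a + k + 2))
              - indicator {0..} s * (s ^ a / (1 + s) ^ (a + Suc k + 2))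
          = indicator {0..} s * (s ^ Suc a / (1 + s) ^ (Suc a + k + 2))" for s :: real
    proof (cases "0 \<le> s")
      case True
      have "u / t ^ N - u / t ^ Suc N = (t - 1) * u / t ^ Suc N" if "t \<noteq> 0" for t u :: real and N
        using that by (simp add: field_simps)
      from this[of "1 + s" "s ^ a" "a + k + 2"] show ?thesis
        using True by simp
    qed simp
  qed
  also have "fact a * fact k / fact (a + k + 1) - fact a * fact (Suc k) / fact (a + Suc k + 1)
       = fact a * fact k * (real (a + k + 2) - real (k + 1)) / (fact (a + Suc k + 1) :: real)"
    by (simp add: divide_simps) (simp add: algebra_simps)
  also have "\<dots> = fact (Suc a) * fact k / fact (Suc a + k + 1)"
    by (simp add: algebra_simps)
  finally show ?case .
qed

text \<open>
  The density of the beta prime distribution with parameters \<open>a + 1\<close> and \<open>m + 1\<close>; the shifts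
  keep all exponents natural numbers.
\<close>

definition beta_prime_density :: "nat \<Rightarrow> nat \<Rightarrow> real \<Rightarrow> real" where
  "beta_prime_density m a s =
     fact (a + m + 1) / (fact a * fact m) * (s ^ a / (1 + s) ^ (a + m + 2))"

text \<open>
  Multiplication by \<open>s\<^sup>j\<close> trades \<open>j\<close> units of the second parameter for \<open>j\<close> units of the first, so the
  moment of order \<open>j\<close> exists once the second parameter exceeds \<open>j\<close>; hence the form \<open>k + j\<close>.
\<close>

lemma beta_prime_moment:
  "has_bochner_integral lborel
     (\<lambda>s. indicator {0..} s * (beta_prime_density (k + j) a s * s ^ j))
     (fact (a + j) * fact k / (fact a * fact (k + j)))"
proof -
  have "has_bochner_integral lborel
     (\<lambda>s::real. fact (a + (k + j) + 1) / (fact a * fact (k + j)) *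
       (indicator {0..} s * (s ^ (a + j) / (1 + s) ^ (a + j + k + 2))))
     (fact (a + (k + j) + 1) / (fact a * fact (k + j)) *
       (fact (a + j) * fact k / fact (a + j + k + 1)))"
    by (rule has_bochner_integral_mult_right) (rule has_integral_beta_prime)
  then show ?thesis
    by (simp add: beta_prime_density_def power_add ac_simps)
qed

text \<open>
  The bracket on the right is the second moment of the beta prime distribution about \<open>x\<close>, expanded by
  linearity.  The majorant also supplies the integrability of \<open>g\<close> against the density.
\<close>

lemma beta_prime_average_deviation:
  fixes g :: "real \<Rightarrow> real"
  assumes cont: "continuous_on {0..} g"
    and dev: "\<And>s. s \<ge> 0 \<Longrightarrow> \<bar>g s - c\<bar> \<le> \<epsilon> + M * (s - x)\<^sup>2"
    and "m \<ge> 2"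
  shows "\<bar>(LBINT s:{0..}. beta_prime_density m a s * g s) - c\<bar> \<le>
           \<epsilon> + M * ((real a + 1) * (real a + 2) / (real m * (real m - 1))
             - 2 * x * ((real a + 1) / real m) + x\<^sup>2)"
proof -
  obtain k where m: "m = k + 2"
    using \<open>m \<ge> 2\<close> le_Suc_ex by (metis add.commute)
  define w where "w = beta_prime_density m a"
  have w0: "has_bochner_integral lborel (\<lambda>s. indicator {0..} s * w s) 1"
    using beta_prime_moment[of m 0 a] by (simp add: w_def)
  have w1: "has_bochner_integral lborel (\<lambda>s. indicator {0..} s * (w s * s))
      ((real a + 1) / real m)"
    using beta_prime_moment[of "k + 1" 1 a] by (simp add: w_def m ac_simps)
  have w2: "has_bochner_integral lborel (\<lambda>s. indicator {0..} s * (w s * s\<^sup>2))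
      ((real a + 1) * (real a + 2) / (real m * (real m - 1)))"
  proof -
    have "fact (a + 2) * fact k / (fact a * fact (k + 2)) =
        (real a + 1) * (real a + 2) / (real m * (real m - 1))"
      by (simp add: m numeral_2_eq_2 ac_simps)
    then show ?thesis
      using beta_prime_moment[of k 2 a] by (simp add: w_def m)
  qed
  have w_nonneg: "w s \<ge> 0" if "s \<ge> 0" for s
    using that by (simp add: w_def beta_prime_density_def)
  have w_cont: "continuous_on {0..} w"
    unfolding w_def beta_prime_density_def by (intro continuous_intros) auto
  have major: "has_bochner_integral lborel
      (\<lambda>s. indicator {0..} s * (w s * (\<epsilon> + M * (s - x)\<^sup>2)))
      (\<epsilon> + M * ((real a + 1) * (real a + 2) / (real m * (real m - 1))
             - 2 * x * ((real a + 1) / real m) + x\<^sup>2))" (is "has_bochner_integral _ _ ?B")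
  proof -
    have "has_bochner_integral lborel
      (\<lambda>s. (\<epsilon> + M * x\<^sup>2) * (indicator {0..} s * w s)
          - 2 * M * x * (indicator {0..} s * (w s * s)) + M * (indicator {0..} s * (w s * s\<^sup>2)))
      ((\<epsilon> + M * x\<^sup>2) * 1 - 2 * M * x * ((real a + 1) / real m) +
         M * ((real a + 1) * (real a + 2) / (real m * (real m - 1))))"
      by (intro has_bochner_integral_add has_bochner_integral_diff
          has_bochner_integral_mult_right w0 w1 w2)
    then show ?thesis
      by (simp add: algebra_simps power2_eq_square)
  qed
  have "set_integrable lborel {0..} (\<lambda>s. w s * (g s - c))"
  proof (rule set_integrable_bound)
    show "set_integrable lborel {0..} (\<lambda>s. w s * (\<epsilon> + M * (s - x)\<^sup>2))"
      using major by (auto simp: set_integrable_def has_bochner_integral_iff)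
    have "continuous_on {0..} (\<lambda>s. w s * (g s - c))"
      by (intro continuous_intros w_cont cont)
    then show "set_borel_measurable lborel {0..} (\<lambda>s. w s * (g s - c))"
      using borel_measurable_continuous_on_indicator[of "{0..}" "\<lambda>s. w s * (g s - c)"]
      by (simp add: set_borel_measurable_def)
    show "AE s in lborel. s \<in> {0..} \<longrightarrow>
        norm (w s * (g s - c)) \<le> norm (w s * (\<epsilon> + M * (s - x)\<^sup>2))"
      using w_nonneg dev by (intro AE_I2) (force simp: abs_mult intro!: mult_left_mono)
  qed
  then have h: "integrable lborel (\<lambda>s. indicator {0..} s * (w s * (g s - c)))"
    by (simp add: set_integrable_def)
  have "has_bochner_integral lborel
      (\<lambda>s. indicator {0..} s * (w s * (g s - c)) + c * (indicator {0..} s * w s))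
      ((\<integral>s. indicator {0..} s * (w s * (g s - c)) \<partial>lborel) + c * 1)"
    by (intro has_bochner_integral_add has_bochner_integral_mult_right w0
        has_bochner_integral_integrable h)
  then have "(LBINT s:{0..}. w s * g s) - c = (\<integral>s. indicator {0..} s * (w s * (g s - c)) \<partial>lborel)"
    by (simp add: set_lebesgue_integral_def has_bochner_integral_iff algebra_simps)
  also have "\<bar>\<dots>\<bar> \<le> (\<integral>s. \<bar>indicator {0..} s * (w s * (g s - c))\<bar> \<partial>lborel)"
    by (rule integral_abs_bound)
  also have "\<dots> \<le> (\<integral>s. indicator {0..} s * (w s * (\<epsilon> + M * (s - x)\<^sup>2)) \<partial>lborel)"
    using major h w_nonneg dev
    by (intro integral_mono integrable_abs)
       (auto simp: has_bochner_integral_iff abs_mult intro!: mult_left_mono split: split_indicator)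
  also have "\<dots> = ?B"
    using major by (simp add: has_bochner_integral_iff)
  finally show ?thesis
    by (simp add: w_def)
qed

section \<open>The operators as iterated averages\<close>

text \<open>
  The conditional expectation of \<open>g(S)\<close> given \<open>r\<close>.  The node \<open>r = 0\<close>, where the beta prime distribution
  degenerates to the point mass at \<open>0\<close>, accounts for the separate term \<open>g 0\<close> of the operator.
\<close>

definition node_average :: "nat \<Rightarrow> (real \<Rightarrow> real) \<Rightarrow> nat \<Rightarrow> real" where
  "node_average n g r =
     (if r = 0 then g 0 else LBINT s:{0..}. beta_prime_density (n - 2) (r - 1) s * g s)"

lemma T_summand_eq_node_average:
  assumes "n \<ge> 2"
  shows "(real n - 1) * T_summand \<nu> n g x (Suc a) =
           (real n * x) ^ Suc a / gamma_dunkl \<nu> (Suc a) * node_average n g (Suc a)"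
proof -
  obtain m where n: "n = m + 2"
    using assms le_Suc_ex by (metis add.commute)
  have powi: "(1 + s) powi (- int n - int (Suc a) + 1) = 1 / (1 + s) ^ (a + m + 2)" for s :: real
  proof -
    have "- int n - int (Suc a) + 1 = - int (a + m + 2)" by (simp add: n)
    then show ?thesis
      by (simp only: power_int_minus power_int_of_nat) (simp add: divide_inverse)
  qed
  have binom: "(real n - 1) * real ((n + Suc a - 2) choose (Suc a - 1)) =
      fact (a + m + 1) / (fact a * fact m)"
  proof -
    have "real ((a + m + 1) choose a) = fact (a + m + 1) / (fact a * fact (m + 1))"
      by (subst binomial_fact) auto
    then show ?thesis by (simp add: n add.commute add.left_commute)
  qed
  have average: "fact (a + m + 1) / (fact a * fact m) *
      (LBINT s:{0..}. s ^ a * (1 / (1 + s) ^ (a + m + 2)) * g s) =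
      (LBINT s:{0..}. beta_prime_density m a s * g s)"
    by (simp add: beta_prime_density_def mult.assoc flip: set_integral_mult_right)
  have "(real n - 1) * T_summand \<nu> n g x (Suc a) =
      (real n * x) ^ Suc a / gamma_dunkl \<nu> (Suc a) *
      (((real n - 1) * real ((n + Suc a - 2) choose (Suc a - 1))) *
       (LBINT s:{0..}. s ^ a * (1 / (1 + s) ^ (a + m + 2)) * g s))"
    unfolding T_summand_def powi by simp
  also have "\<dots> = (real n * x) ^ Suc a / gamma_dunkl \<nu> (Suc a) * node_average n g (Suc a)"
    unfolding binom average node_average_def by (simp add: n)
  finally show ?thesis .
qed

text \<open>
  With \<open>r = a + 1\<close> the moments of the beta prime distribution become expressions in \<open>r\<close> that
  are also correct for the point mass at \<open>r = 0\<close>, so all nodes can be averaged uniformly.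
\<close>

lemma node_average_deviation:
  fixes g :: "real \<Rightarrow> real"
  assumes "continuous_on {0..} g"
    and "\<And>s. s \<ge> 0 \<Longrightarrow> \<bar>g s - c\<bar> \<le> \<epsilon> + M * (s - x)\<^sup>2"
    and "n \<ge> 4"
  shows "\<bar>node_average n g r - c\<bar> \<le>
           \<epsilon> + M * (real r * (real r + 1) / ((real n - 2) * (real n - 3))
             - 2 * x * (real r / (real n - 2)) + x\<^sup>2)"
proof (cases r)
  case 0
  then show ?thesis
    using assms(2)[of 0] by (simp add: node_average_def)
next
  case (Suc a)
  then show ?thesis
    using beta_prime_average_deviation[of g c \<epsilon> M x "n - 2" a] assms
    by (simp add: node_average_def of_nat_diff add.commute)
qed

text \<open>
  The leading terms of the second moment cancel:
  \<open>n\<^sup>2 / ((n - 2) (n - 3)) - 2 n / (n - 2) + 1 = (n + 6) / ((n - 2) (n - 3))\<close>, which leaves a quantity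
  of order \<open>1 / n\<close>.
\<close>

lemma T_op_deviation:
  fixes g :: "real \<Rightarrow> real"
  assumes "\<nu> \<ge> 0" and cont: "continuous_on {0..} g"
    and dev: "\<And>s. s \<ge> 0 \<Longrightarrow> \<bar>g s - g x\<bar> \<le> \<epsilon> + M * (s - x)\<^sup>2"
    and "M \<ge> 0" "n \<ge> 4" "x \<ge> 0"
  shows "\<bar>T_op \<nu> n g x - g x\<bar> \<le>
           \<epsilon> + M * ((x\<^sup>2 * (real n + 6) + 2 * real n * x) / ((real n - 2) * (real n - 3))
                     + 4 * \<nu> * x / (real n - 2))"
proof -
  define y where "y = real n * x"
  define e where "e = exp_dunkl \<nu> y"
  define p where "p r = y ^ r / gamma_dunkl \<nu> r / e" for r
  define N2 where "N2 = real n - 2"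
  define N3 where "N3 = real n - 3"
  define d where "d = dunkl_nat \<nu>"
  have "y \<ge> 0" using \<open>x \<ge> 0\<close> by (simp add: y_def)
  have "e > 0" using exp_dunkl_pos[OF \<open>\<nu> \<ge> 0\<close> \<open>y \<ge> 0\<close>] by (simp add: e_def)
  have N: "N2 > 0" "N3 > 0" using \<open>n \<ge> 4\<close> by (auto simp: N2_def N3_def)
  have p_nonneg: "p r \<ge> 0" for r
    using \<open>y \<ge> 0\<close> \<open>e > 0\<close> gamma_dunkl_pos[OF \<open>\<nu> \<ge> 0\<close>, of r] by (simp add: p_def)
  have p0: "p sums 1"
    using sums_divide[OF exp_dunkl_sums[OF \<open>\<nu> \<ge> 0\<close>, of y], of e] \<open>e > 0\<close>
    by (simp add: p_def[abs_def] e_def)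
  have p1: "(\<lambda>r. d r * p r) sums y"
    using sums_divide[OF dunkl_nat_sums[OF \<open>\<nu> \<ge> 0\<close>, of y], of e] \<open>e > 0\<close>
    by (simp add: p_def[abs_def] e_def d_def)
  have p2: "(\<lambda>r. d r * d (r - 1) * p r) sums y\<^sup>2"
    using sums_divide[OF dunkl_nat_dunkl_nat_sums[OF \<open>\<nu> \<ge> 0\<close>, of y], of e] \<open>e > 0\<close>
    by (simp add: p_def[abs_def] e_def d_def)
  \<comment> \<open>A bound for the deviation at the node \<open>r\<close> that is a linear combination of the summable moments.\<close>
  define b where "b r = \<epsilon> + M * ((d r * d (r - 1) + 2 * d r) / (N2 * N3)
      - 2 * x * ((d r - 2 * \<nu>) / N2) + x\<^sup>2)" for r
  have b: "\<bar>node_average n g r - g x\<bar> \<le> b r" for r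
  proof -
    have "real r * (real r + 1) / (N2 * N3) \<le> (d r * d (r - 1) + 2 * d r) / (N2 * N3)"
      using rising_product_le_dunkl_nat[OF \<open>\<nu> \<ge> 0\<close>, of r] N
      by (intro divide_right_mono) (auto simp: d_def)
    moreover have "2 * x * ((d r - 2 * \<nu>) / N2) \<le> 2 * x * (real r / N2)"
      using dunkl_nat_minus_le[OF \<open>\<nu> \<ge> 0\<close>, of r] N \<open>x \<ge> 0\<close>
      by (intro mult_left_mono divide_right_mono) (auto simp: d_def)
    ultimately have "\<epsilon> + M * (real r * (real r + 1) / (N2 * N3) - 2 * x * (real r / N2) + x\<^sup>2)
        \<le> b r"
      unfolding b_def using \<open>M \<ge> 0\<close> by (intro add_left_mono mult_left_mono) auto
    then show ?thesis
      using node_average_deviation[OF cont dev \<open>n \<ge> 4\<close>, of r] by (simp add: N2_def N3_def)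
  qed
  define B where "B = \<epsilon> + M * ((y\<^sup>2 + 2 * y) / (N2 * N3) - 2 * x * ((y - 2 * \<nu>) / N2) + x\<^sup>2)"
  have "(\<lambda>r. \<epsilon> * p r + M * ((d r * d (r - 1) * p r + 2 * (d r * p r)) / (N2 * N3)
      - 2 * x * ((d r * p r - 2 * \<nu> * p r) / N2) + x\<^sup>2 * p r)) sums
      (\<epsilon> * 1 + M * ((y\<^sup>2 + 2 * y) / (N2 * N3) - 2 * x * ((y - 2 * \<nu> * 1) / N2) + x\<^sup>2 * 1))"
    by (intro sums_add sums_diff sums_mult sums_divide p0 p1 p2)
  then have bsums: "(\<lambda>r. b r * p r) sums B"
    by (simp add: b_def B_def algebra_simps add_divide_distrib diff_divide_distrib)
  \<comment> \<open>The convergence of the series of the operator is a consequence of the bound by \<open>b\<close>, too.\<close>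
  have dsum: "summable (\<lambda>r. (node_average n g r - g x) * p r)"
  proof (rule summable_comparison_test')
    show "summable (\<lambda>r. b r * p r)"
      using bsums by (rule sums_summable)
    show "norm ((node_average n g r - g x) * p r) \<le> b r * p r" for r
      using b[of r] p_nonneg[of r] by (simp add: abs_mult mult_right_mono)
  qed
  have "(\<lambda>r. (node_average n g r - g x) * p r + g x * p r) sums
      ((\<Sum>r. (node_average n g r - g x) * p r) + g x * 1)"
    by (intro sums_add sums_mult p0 summable_sums dsum)
  then have "(\<lambda>r. node_average n g r * p r) sums
      ((\<Sum>r. (node_average n g r - g x) * p r) + g x)"
    by (simp add: algebra_simps)
  moreover have "T_op \<nu> n g x = (\<Sum>r. node_average n g r * p r)"
    if s: "summable (\<lambda>r. node_average n g r * p r)"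
  proof -
    have eq: "T_summand \<nu> n g x (Suc k) =
        e / (real n - 1) * (node_average n g (Suc k) * p (Suc k))" for k
    proof -
      have "real n - 1 \<noteq> 0" using \<open>n \<ge> 4\<close> by auto
      then have "T_summand \<nu> n g x (Suc k) =
          1 / (real n - 1) * ((real n - 1) * T_summand \<nu> n g x (Suc k))"
        by simp
      also have "(real n - 1) * T_summand \<nu> n g x (Suc k) =
          e * (node_average n g (Suc k) * p (Suc k))"
        using T_summand_eq_node_average[of n \<nu> g x k] \<open>n \<ge> 4\<close> \<open>e > 0\<close>
        by (simp add: p_def y_def)
      finally show ?thesis by simp
    qed
    have "summable (\<lambda>k. node_average n g (Suc k) * p (Suc k))"
      using s by (subst summable_Suc_iff)
    then have "(\<Sum>k. T_summand \<nu> n g x (Suc k)) =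
        e / (real n - 1) * (\<Sum>k. node_average n g (Suc k) * p (Suc k))"
      unfolding eq by (rule suminf_mult)
    moreover have "(\<Sum>k. node_average n g (Suc k) * p (Suc k)) =
        (\<Sum>r. node_average n g r * p r) - g 0 / e"
      using suminf_split_head[OF s] by (simp add: node_average_def p_def gamma_dunkl_0 \<open>\<nu> \<ge> 0\<close>)
    ultimately show ?thesis
      using \<open>e > 0\<close> \<open>n \<ge> 4\<close> by (simp add: T_op_def flip: y_def e_def)
  qed
  ultimately have "T_op \<nu> n g x - g x = (\<Sum>r. (node_average n g r - g x) * p r)"
    by (auto simp: sums_iff)
  also have "\<bar>\<dots>\<bar> \<le> B"
  proof -
    have "\<bar>(node_average n g r - g x) * p r\<bar> \<le> b r * p r" for r
      using b[of r] p_nonneg[of r] by (simp add: abs_mult mult_right_mono)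
    then have "norm (\<Sum>r. (node_average n g r - g x) * p r) \<le> (\<Sum>r. b r * p r)"
      using bsums by (intro norm_suminf_le) (auto simp: sums_iff)
    then show ?thesis using bsums by (simp add: sums_iff)
  qed
  also have "B = \<epsilon> + M * ((x\<^sup>2 * (real n + 6) + 2 * real n * x) / (N2 * N3) + 4 * \<nu> * x / N2)"
  proof -
    have "(y\<^sup>2 + 2 * y) / (N2 * N3) - 2 * x * ((y - 2 * \<nu>) / N2) + x\<^sup>2 =
        (x\<^sup>2 * (real n + 6) + 2 * real n * x) / (N2 * N3) + 4 * \<nu> * x / N2"
    proof -
      have n: "real n = N3 + 3" "N2 = N3 + 1" by (auto simp: N2_def N3_def)
      show ?thesis
        using N unfolding y_def n by (simp add: divide_simps) (simp add: algebra_simps power2_eq_square)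
    qed
    then show ?thesis by (simp add: B_def)
  qed
  finally show ?thesis by (simp add: N2_def N3_def)
qed

section \<open>Quadratic majorants and the conclusion\<close>

lemma E_space_quadratic_bound:
  assumes cont: "continuous_on {0..} g" and "g \<in> E_space"
  obtains C where "C > 0" "\<And>s. s \<ge> 0 \<Longrightarrow> \<bar>g s\<bar> \<le> C * (1 + s\<^sup>2)"
proof -
  let ?q = "\<lambda>s. g s / (1 + s\<^sup>2)"
  obtain l where l: "(?q \<longlongrightarrow> l) at_top"
    using assms(2) by (auto simp: E_space_def)
  then have "\<forall>\<^sub>F s in at_top. \<bar>?q s - l\<bar> < 1"
    by (auto dest!: tendstoD[where e = 1] simp: dist_real_def)
  then obtain K where K: "\<And>s. s \<ge> K \<Longrightarrow> \<bar>?q s - l\<bar> < 1"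
    by (auto simp: eventually_at_top_linorder)
  have nz: "1 + s\<^sup>2 > 0" for s :: real
    by (simp add: add_pos_nonneg)
  have "continuous_on {0..K} ?q"
    by (intro continuous_intros continuous_on_subset[OF cont]) (use nz in \<open>auto simp: less_imp_neq[symmetric]\<close>)
  then have "bounded (?q ` {0..K})"
    by (intro compact_imp_bounded compact_continuous_image) auto
  then obtain C0 where C0: "\<And>s. s \<in> {0..K} \<Longrightarrow> \<bar>?q s\<bar> \<le> C0"
    unfolding bounded_iff real_norm_def by blast
  define C where "C = max C0 (\<bar>l\<bar> + 1)"
  have "\<bar>g s\<bar> \<le> C * (1 + s\<^sup>2)" if "s \<ge> 0" for s
  proof -
    have "\<bar>?q s\<bar> \<le> C"
      using C0[of s] K[of s] that by (cases "s \<le> K") (auto simp: C_def)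
    then show ?thesis
      using nz[of s] by (simp add: abs_divide pos_divide_le_eq)
  qed
  moreover have "C > 0" by (simp add: C_def)
  ultimately show ?thesis using that by blast
qed

text \<open>
  If \<open>s\<close> is at distance at least \<open>\<delta>\<close> from \<open>x\<close>, then every constant \<open>K \<ge> 0\<close> is at most
  \<open>K (s - x)\<^sup>2 / \<delta>\<^sup>2\<close>, and \<open>s\<^sup>2 \<le> 2 (s - x)\<^sup>2 + 2 x\<^sup>2\<close>; hence the whole quadratic growth of \<open>g\<close> is absorbed
  by a multiple of \<open>(s - x)\<^sup>2\<close>.
\<close>

lemma quadratic_modulus:
  fixes g :: "real \<Rightarrow> real"
  assumes cont: "continuous_on {0..} g" and "g \<in> E_space" and "b \<ge> 0" "\<epsilon> > 0"
  obtains M where "M \<ge> 0"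
    "\<And>x s. x \<in> {0..b} \<Longrightarrow> s \<ge> 0 \<Longrightarrow> \<bar>g s - g x\<bar> \<le> \<epsilon> + M * (s - x)\<^sup>2"
proof -
  obtain C where C: "C > 0" "\<And>s. s \<ge> 0 \<Longrightarrow> \<bar>g s\<bar> \<le> C * (1 + s\<^sup>2)"
    using E_space_quadratic_bound[OF assms(1,2)] by blast
  \<comment> \<open>The extra unit of length contains every \<open>s\<close> close to some \<open>x \<le> b\<close>, as \<open>\<delta> \<le> 1\<close> below.\<close>
  have "uniformly_continuous_on {0..b + 1} g"
    by (intro compact_uniformly_continuous continuous_on_subset[OF cont]) auto
  then obtain \<delta>0 where \<delta>0: "\<delta>0 > 0"
    "\<And>x s. x \<in> {0..b + 1} \<Longrightarrow> s \<in> {0..b + 1} \<Longrightarrow> \<bar>s - x\<bar> < \<delta>0 \<Longrightarrow> \<bar>g s - g x\<bar> < \<epsilon>"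
    using \<open>\<epsilon> > 0\<close> unfolding uniformly_continuous_on_def dist_real_def by metis
  define \<delta> where "\<delta> = min \<delta>0 1"
  define M where "M = C * (2 + 3 * b\<^sup>2) / \<delta>\<^sup>2 + 2 * C"
  have "\<delta> > 0" using \<delta>0 by (simp add: \<delta>_def)
  have "M \<ge> 0" using C \<open>\<delta> > 0\<close> by (simp add: M_def)
  moreover have "\<bar>g s - g x\<bar> \<le> \<epsilon> + M * (s - x)\<^sup>2" if x: "x \<in> {0..b}" and "s \<ge> 0" for x s
  proof (cases "\<bar>s - x\<bar> < \<delta>")
    case True
    then have "\<bar>g s - g x\<bar> < \<epsilon>"
      using x \<open>s \<ge> 0\<close> by (intro \<delta>0) (auto simp: \<delta>_def)
    then show ?thesis using \<open>M \<ge> 0\<close> by (simp add: add_increasing2 less_imp_le)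
  next
    case False
    then have far: "1 \<le> (s - x)\<^sup>2 / \<delta>\<^sup>2"
      using \<open>\<delta> > 0\<close> by (simp add: power_mono[of \<delta> "\<bar>s - x\<bar>" 2, simplified])
    have "x\<^sup>2 \<le> b\<^sup>2" using x by (intro power_mono) auto
    \<comment> \<open>The difference of the two sides is \<open>(s - 2 x)\<^sup>2\<close>.\<close>
    have "s\<^sup>2 \<le> 2 * (s - x)\<^sup>2 + 2 * x\<^sup>2"
      using zero_le_power2[of "s - 2 * x"] by (simp add: power2_eq_square algebra_simps)
    then have s2: "1 + s\<^sup>2 \<le> 1 + 2 * (s - x)\<^sup>2 + 2 * b\<^sup>2"
      using \<open>x\<^sup>2 \<le> b\<^sup>2\<close> by linarith
    have "\<bar>g s - g x\<bar> \<le> \<bar>g s\<bar> + \<bar>g x\<bar>" by simp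
    also have "\<dots> \<le> C * (1 + s\<^sup>2) + C * (1 + x\<^sup>2)"
      using C(2)[of s] C(2)[of x] x \<open>s \<ge> 0\<close> by auto
    also have "\<dots> \<le> C * (1 + 2 * (s - x)\<^sup>2 + 2 * b\<^sup>2) + C * (1 + b\<^sup>2)"
      using C(1) s2 \<open>x\<^sup>2 \<le> b\<^sup>2\<close> by (intro add_mono[OF mult_left_mono mult_left_mono]) auto
    also have "\<dots> = C * (2 + 3 * b\<^sup>2) * 1 + 2 * C * (s - x)\<^sup>2"
      by (simp add: algebra_simps)
    also have "\<dots> \<le> C * (2 + 3 * b\<^sup>2) * ((s - x)\<^sup>2 / \<delta>\<^sup>2) + 2 * C * (s - x)\<^sup>2"
      using C(1) far by (intro add_mono mult_left_mono) auto
    also have "\<dots> = M * (s - x)\<^sup>2"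
      by (simp add: M_def algebra_simps add_divide_distrib)
    finally show ?thesis using \<open>\<epsilon> > 0\<close> by simp
  qed
  ultimately show ?thesis using that by blast
qed

theorem theorem4:
  fixes \<nu> :: real and g :: "real \<Rightarrow> real" and A :: "real set"
  assumes "\<nu> \<ge> 0"
    and "continuous_on {0..} g"
    and "g \<in> E_space"
    and "compact A" and "A \<subseteq> {0..}"
  shows "uniform_limit A (\<lambda>n x. T_op \<nu> n g x) g sequentially"
proof (rule uniform_limitI)
  fix \<epsilon> :: real assume "\<epsilon> > 0"
  obtain b where b: "b \<ge> 0" "A \<subseteq> {0..b}"
  proof -
    obtain b where "\<And>x. x \<in> A \<Longrightarrow> \<bar>x\<bar> \<le> b"
      using compact_imp_bounded[OF assms(4)] by (auto simp: bounded_iff)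
    then have "A \<subseteq> {0..max b 0}" using assms(5) by fastforce
    then show ?thesis using that[of "max b 0"] by simp
  qed
  obtain M where M: "M \<ge> 0"
    "\<And>x s. x \<in> {0..b} \<Longrightarrow> s \<ge> 0 \<Longrightarrow> \<bar>g s - g x\<bar> \<le> \<epsilon> / 2 + M * (s - x)\<^sup>2"
    using quadratic_modulus[OF assms(2,3) b(1), of "\<epsilon> / 2"] \<open>\<epsilon> > 0\<close> by auto
  define R where "R n = M * ((b\<^sup>2 * (real n + 6) + 2 * real n * b) / ((real n - 2) * (real n - 3))
      + 4 * \<nu> * b / (real n - 2))" for n
  have "R \<longlonglongrightarrow> 0"
    unfolding R_def by real_asymp
  then have "\<forall>\<^sub>F n in sequentially. R n < \<epsilon> / 2"
    using \<open>\<epsilon> > 0\<close> by (intro order_tendstoD) auto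
  moreover have "\<forall>\<^sub>F n in sequentially. n \<ge> 4"
    by (rule eventually_ge_at_top)
  ultimately show "\<forall>\<^sub>F n in sequentially. \<forall>x\<in>A. dist (T_op \<nu> n g x) (g x) < \<epsilon>"
  proof eventually_elim
    case (elim n)
    show ?case
    proof
      fix x assume "x \<in> A"
      then have x: "x \<in> {0..b}" using b by auto
      have "\<bar>T_op \<nu> n g x - g x\<bar> \<le> \<epsilon> / 2 +
          M * ((x\<^sup>2 * (real n + 6) + 2 * real n * x) / ((real n - 2) * (real n - 3))
            + 4 * \<nu> * x / (real n - 2))"
        using x M elim by (intro T_op_deviation assms(1,2)) auto
      also have "\<dots> \<le> \<epsilon> / 2 + R n"
        unfolding R_def using x M(1) elim(2) assms(1) 
        by (intro add_left_mono mult_left_mono add_mono divide_right_mono mult_right_mono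
            power_mono) auto
      also have "\<dots> < \<epsilon>" using elim(1) by simp
      finally show "dist (T_op \<nu> n g x) (g x) < \<epsilon>"
        by (simp add: dist_real_def)
    qed
  qed
qed

end
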